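(* For a triangle with interior angles listed in nondecreasing order $\alpha=(\alpha_0,\alpha_1,\alpha_2)$ and a triangle with interior angles listed in nondecreasing order $\beta=(\beta_0,\beta_1,\beta_2)$, let $\tau(\alpha,\beta)\ge 0$ be defined by $$\tau^2(\alpha,\beta)=\frac{\sin^2(\alpha_1)}{\sin^2(\alpha_2)}+\frac{\sin^2(\beta_1)}{\sin^2(\beta_2)}-2\,\frac{\sin(\alpha_1)\sin(\beta_1)}{\sin(\alpha_2)\sin(\beta_2)}\cos(\alpha_0-\beta_0).$$ Then $\tau$ is a valid metric for comparing triangles. That is, writing $\tau(A,B)$ for the value of $\tau$ on the ordered angle sequences of triangles $A$ and $B$, for all triangles $A,B,C$: (1) $\tau(A,B)\ge 0$; (2) $\tau(A,B)=0$ if and only if $A$ and $B$ are similar; (3) $\tau(A,B)=\tau(B,A)$; (4) $\tau(A,C)\le\tau(A,B)+\tau(B,C)$.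
   Context: Triangles are non-degenerate triangles in the Euclidean plane. Two triangles are similar if one is obtained from the other by a translation, rotation, uniform scaling, and/or reflection, up to a permutation of the vertices. For the purposes of the metric, similar triangles are regarded as equal. *)

theory Defs
  imports "HOL-Analysis.Analysis"
begin

type_synonym triangle = "(real^2) \<times> (real^2) \<times> (real^2)"

fun is_triangle :: "triangle \<Rightarrow> bool" where
  "is_triangle (P, Q, R) \<longleftrightarrow> \<not> collinear {P, Q, R}"

text \<open>The angle at \<open>Q\<close> between the rays \<open>QP\<close> and \<open>QR\<close>, a number in \<open>[0, \<pi>]\<close>.\<close>

definition angle_at :: "real^2 \<Rightarrow> real^2 \<Rightarrow> real^2 \<Rightarrow> real" where
  "angle_at P Q R = arccos (((P - Q) \<bullet> (R - Q)) / (norm (P - Q) * norm (R - Q)))"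

fun sorted_angles :: "triangle \<Rightarrow> real list" where
  "sorted_angles (P, Q, R) = sort [angle_at R P Q, angle_at P Q R, angle_at Q R P]"

text \<open>In the plane an orthogonal transformation is a rotation or a reflection.\<close>

definition similarity_map :: "(real^2 \<Rightarrow> real^2) \<Rightarrow> bool" where
  "similarity_map f \<longleftrightarrow>
     (\<exists>g c t. orthogonal_transformation g \<and> c > 0 \<and> f = (\<lambda>x. c *\<^sub>R g x + t))"

text \<open>Equality of multisets of vertices allows an arbitrary permutation of the vertices.\<close>

fun similar_triangles :: "triangle \<Rightarrow> triangle \<Rightarrow> bool" where
  "similar_triangles (P, Q, R) (P', Q', R') \<longleftrightarrow>
     (\<exists>f. similarity_map f \<and> {#f P, f Q, f R#} = {#P', Q', R'#})"

definition tau_sq :: "real list \<Rightarrow> real list \<Rightarrow> real" where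
  "tau_sq \<alpha> \<beta> =
     (sin (\<alpha> ! 1))\<^sup>2 / (sin (\<alpha> ! 2))\<^sup>2 + (sin (\<beta> ! 1))\<^sup>2 / (sin (\<beta> ! 2))\<^sup>2
     - 2 * ((sin (\<alpha> ! 1) * sin (\<beta> ! 1)) / (sin (\<alpha> ! 2) * sin (\<beta> ! 2))) * cos (\<alpha> ! 0 - \<beta> ! 0)"

text \<open>
  The library's real square root is odd, \<open>sqrt (- x) = - sqrt x\<close>. Hence nonnegativity of
  \<open>tau\<close> is not automatic: it says exactly that \<open>tau_sq\<close> is nonnegative, i.e. that the
  nonnegative number with square \<open>tau_sq\<close> exists.
\<close>

definition tau :: "real list \<Rightarrow> real list \<Rightarrow> real" where
  "tau \<alpha> \<beta> = sqrt (tau_sq \<alpha> \<beta>)"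

lemma tau_nonneg_iff: "tau \<alpha> \<beta> \<ge> 0 \<longleftrightarrow> (tau \<alpha> \<beta>)\<^sup>2 = tau_sq \<alpha> \<beta>"
  by (metis real_sqrt_ge_0_iff real_sqrt_pow2_iff tau_def)

definition triangle_tau :: "triangle \<Rightarrow> triangle \<Rightarrow> real" where
  "triangle_tau A B = tau (sorted_angles A) (sorted_angles B)"

end

theory Submission
  imports Defs
begin

text \<open>
  Scale a triangle so that its longest side is the segment from 0 to 1 in the complex plane, with
  the smallest angle at 0. By the law of sines its third vertex, the apex, is the point
  $(\sin\alpha_1/\sin\alpha_2)\,e^{i\alpha_0}$, and the law of cosines says that $\tau$ is the
  Euclidean distance between two such points. All metric properties are inherited from the plane,
  and two triangles with the same apex are similar because they agree in the ratio of two sides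
  and in the enclosed angle.
\<close>

section \<open>The apex and tau as a planar distance\<close>

definition apex :: "real list \<Rightarrow> complex" where
  "apex \<alpha> = of_real (sin (\<alpha> ! 1) / sin (\<alpha> ! 2)) * cis (\<alpha> ! 0)"

lemma tau_eq_dist_apex: "tau \<alpha> \<beta> = dist (apex \<alpha>) (apex \<beta>)"
proof -
  define r s where "r = sin (\<alpha> ! 1) / sin (\<alpha> ! 2)" and "s = sin (\<beta> ! 1) / sin (\<beta> ! 2)"
  define a b where "a = \<alpha> ! 0" and "b = \<beta> ! 0"
  have "tau_sq \<alpha> \<beta> = r\<^sup>2 + s\<^sup>2 - 2 * (r * s) * cos (a - b)"
    by (simp add: tau_sq_def r_def s_def a_def b_def power_divide)
  \<comment> \<open>The factors equal to 1 complete both squares: once \<open>cos (a - b)\<close> is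
    expanded, what remains is a polynomial identity. Its right-hand side is a sum of squares, so
    \<open>tau_sq\<close> is nonnegative and \<open>sqrt\<close> acts as an ordinary square
    root.\<close>
  also have "\<dots> = r\<^sup>2 * ((sin a)\<^sup>2 + (cos a)\<^sup>2) + s\<^sup>2 * ((sin b)\<^sup>2 + (cos b)\<^sup>2) - 2 * (r * s) * cos (a - b)"
    by simp
  also have "\<dots> = (r * cos a - s * cos b)\<^sup>2 + (r * sin a - s * sin b)\<^sup>2"
    unfolding cos_diff by algebra
  finally show ?thesis
    by (simp add: tau_def dist_norm cmod_def apex_def r_def s_def a_def b_def)
qed

section \<open>Angles and the law of sines\<close>

lemma angle_at_commute: "angle_at P Q R = angle_at R Q P"
  by (simp add: angle_at_def inner_commute mult.commute)

text \<open>This is Cauchy-Schwarz. For a zero vector the quotient is 0, since division by zero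
  yields 0; hence \<open>cos_angle_at\<close> covers degenerate angles too.\<close>

lemma abs_inner_div_norms_le_1: "\<bar>x \<bullet> y / (norm x * norm y)\<bar> \<le> 1"
  using Cauchy_Schwarz_ineq2[of x y] by (auto simp: abs_mult divide_le_eq_1)

lemma cos_angle_at:
  "cos (angle_at P Q R) = ((P - Q) \<bullet> (R - Q)) / (norm (P - Q) * norm (R - Q))"
  unfolding angle_at_def by (rule cos_arccos_abs[OF abs_inner_div_norms_le_1])

lemma angle_at_bounds: "0 \<le> angle_at P Q R" "angle_at P Q R \<le> pi"
  using abs_inner_div_norms_le_1[of "P - Q" "R - Q"]
  unfolding angle_at_def by (simp_all only: abs_le_iff arccos_lbound arccos_ubound minus_le_iff)

text \<open>The square root is twice the area of the triangle.\<close>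

lemma sin_angle_at:
  assumes "P \<noteq> Q" "R \<noteq> Q"
  shows "sin (angle_at P Q R) =
    sqrt ((norm (P - Q))\<^sup>2 * (norm (R - Q))\<^sup>2 - ((P - Q) \<bullet> (R - Q))\<^sup>2) / (norm (P - Q) * norm (R - Q))"
proof -
  have "sin (angle_at P Q R) = sqrt (1 - (cos (angle_at P Q R))\<^sup>2)"
    by (rule sin_cos_sqrt) (use angle_at_bounds in \<open>auto intro: sin_ge_zero\<close>)
  also have "1 - (cos (angle_at P Q R))\<^sup>2 =
      ((norm (P - Q))\<^sup>2 * (norm (R - Q))\<^sup>2 - ((P - Q) \<bullet> (R - Q))\<^sup>2) / (norm (P - Q) * norm (R - Q))\<^sup>2"
    using assms by (simp add: cos_angle_at field_simps power_mult_distrib)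
  finally show ?thesis
    by (simp add: real_sqrt_divide)
qed

text \<open>Law of sines: each sine is twice the area over the product of the adjacent sides, so the
  area and the common side \<open>QR\<close> cancel in the quotient.\<close>

lemma sin_angle_at_ratio:
  assumes "\<not> collinear {P, Q, R}"
  shows "sin (angle_at P Q R) / sin (angle_at Q R P) = norm (R - P) / norm (Q - P)"
proof -
  have ne: "P \<noteq> Q" "Q \<noteq> R" "P \<noteq> R"
    using assms by (auto simp: insert_commute)
  define D where "D = sqrt ((norm (P - Q))\<^sup>2 * (norm (R - Q))\<^sup>2 - ((P - Q) \<bullet> (R - Q))\<^sup>2)"
  \<comment> \<open>Equality in Cauchy-Schwarz would make the three points collinear; this is why
    the area, and hence \<open>D\<close>, does not vanish.\<close>
  have "\<bar>(P - Q) \<bullet> (R - Q)\<bar> \<noteq> norm (P - Q) * norm (R - Q)"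
    using assms by (simp add: norm_cauchy_schwarz_equal collinear_3[of P Q R])
  then have "((P - Q) \<bullet> (R - Q))\<^sup>2 \<noteq> (norm (P - Q) * norm (R - Q))\<^sup>2"
    by (auto simp only: power2_eq_iff abs_mult abs_norm_cancel abs_minus_cancel)
  then have "D \<noteq> 0"
    by (auto simp: D_def power_mult_distrib)
  \<comment> \<open>The Gram determinant is the same at the vertices \<open>Q\<close> and
    \<open>R\<close>, so one \<open>D\<close> serves both sines.\<close>
  have "(norm (P - Q))\<^sup>2 * (norm (R - Q))\<^sup>2 - ((P - Q) \<bullet> (R - Q))\<^sup>2 =
      (norm (Q - R))\<^sup>2 * (norm (P - R))\<^sup>2 - ((Q - R) \<bullet> (P - R))\<^sup>2"
    unfolding power2_norm_eq_inner inner_diff_left inner_diff_right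
      inner_commute[of Q P] inner_commute[of R P] inner_commute[of R Q]
    by algebra
  then have "sin (angle_at Q R P) = D / (norm (Q - R) * norm (P - R))"
    using sin_angle_at[of Q R P] ne by (simp add: D_def)
  moreover have "sin (angle_at P Q R) = D / (norm (P - Q) * norm (R - Q))"
    using sin_angle_at[of P Q R] ne by (simp add: D_def)
  ultimately show ?thesis
    using ne \<open>D \<noteq> 0\<close>
    by (simp add: norm_minus_commute[of P Q] norm_minus_commute[of P R] norm_minus_commute[of Q R])
qed

section \<open>Sorted angles under relabelling and similarity\<close>

text \<open>The two adjacent transpositions generate all permutations of three entries. The first
  triple stays fixed, so invariance has to be checked for two swaps of the second triple
  only.\<close>

lemma mset_3_induct [consumes 1, case_names refl swap_left swap_right]:
  assumes "{#x, y, z#} = {#x', y', z'#}"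
    and "\<And>a b c. S a b c a b c"
    and "\<And>a b c a' b' c'. S a b c a' b' c' \<Longrightarrow> S a b c b' a' c'"
    and "\<And>a b c a' b' c'. S a b c a' b' c' \<Longrightarrow> S a b c a' c' b'"
  shows "S x y z x' y' z'"
proof -
  have "(x', y', z') \<in> {(x, y, z), (x, z, y), (y, x, z), (y, z, x), (z, x, y), (z, y, x)}"
    using assms(1) by (auto simp: add_eq_conv_ex)
  moreover note xyz = assms(2)[of x y z]
  moreover note xzy = assms(4)[OF xyz] and yxz = assms(3)[OF xyz]
  moreover note zxy = assms(3)[OF xzy] and yzx = assms(4)[OF yxz]
  moreover note zyx = assms(4)[OF zxy]
  ultimately show ?thesis
    by auto
qed

lemma sorted_angles_cong_mset:
  assumes "{#P, Q, R#} = {#P', Q', R'#}"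
  shows "sorted_angles (P, Q, R) = sorted_angles (P', Q', R')"
proof -
  \<comment> \<open>Sorting depends only on the multiset of angles, and a swap of two vertices
    merely rearranges the angles and exchanges their arms.\<close>
  have *: "sorted_angles (P, Q, R) =
      sorted_list_of_multiset {#angle_at R P Q, angle_at P Q R, angle_at Q R P#}" for P Q R
    by (simp only: sorted_angles.simps flip: sorted_list_of_multiset_mset) simp
  show ?thesis
    unfolding * using assms
    by (induction rule: mset_3_induct) (simp_all only: angle_at_commute add_mset_commute)
qed

text \<open>The translation cancels in differences, the orthogonal part preserves inner products and
  norms, and the scale factor enters numerator and denominator alike as
  \<open>c * c\<close>.\<close>

lemma similarity_map_angle_at:
  assumes "similarity_map f"
  shows "angle_at (f P) (f Q) (f R) = angle_at P Q R"
proof -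
  from assms obtain g c t where g: "orthogonal_transformation g" and "c > 0"
    and f: "f = (\<lambda>x. c *\<^sub>R g x + t)"
    unfolding similarity_map_def by blast
  have diff: "f x - f y = c *\<^sub>R g (x - y)" for x y
    using g by (simp add: f orthogonal_transformation_def linear_diff scaleR_diff_right)
  have "norm (g x) = norm x" "g x \<bullet> g y = x \<bullet> y" for x y
    using g by (auto simp: orthogonal_transformation_norm orthogonal_transformation_def)
  then show ?thesis
    using \<open>c > 0\<close> by (simp add: angle_at_def diff)
qed

lemma similarity_map_sorted_angles:
  "similarity_map f \<Longrightarrow> sorted_angles (f P, f Q, f R) = sorted_angles (P, Q, R)"
  by (simp only: sorted_angles.simps similarity_map_angle_at)

lemma similar_triangles_sorted_angles:
  assumes "similar_triangles A B"
  shows "sorted_angles A = sorted_angles B"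
proof -
  obtain P Q R P' Q' R' where "A = (P, Q, R)" "B = (P', Q', R')"
    by (metis prod_cases3)
  with assms similarity_map_sorted_angles sorted_angles_cong_mset show ?thesis
    by (metis similar_triangles.simps)
qed

text \<open>Provides a labelling with the smallest angle at \<open>P'\<close> and the largest at
  \<open>R'\<close>, so that positions in the sorted list correspond to vertices.\<close>

lemma sorted_angles_vertices:
  obtains P' Q' R' where "{#P', Q', R'#} = {#P, Q, R#}"
    "sorted_angles (P, Q, R) = [angle_at R' P' Q', angle_at P' Q' R', angle_at Q' R' P']"
proof -
  have "\<exists>P' Q' R'. {#P', Q', R'#} = {#P, Q, R#} \<and>
      angle_at R' P' Q' \<le> angle_at P' Q' R' \<and> angle_at P' Q' R' \<le> angle_at Q' R' P'"
  proof -
    define p q r where "p = angle_at R P Q" "q = angle_at P Q R" "r = angle_at Q R P"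
    note * = p_q_r_def
    \<comment> \<open>Odd relabellings exchange the arms of every angle; these forms serve cases 2,
      3 and 6.\<close>
    have sym: "angle_at Q P R = p" "angle_at R Q P = q" "angle_at P R Q = r"
      by (simp_all add: * angle_at_commute)
    consider "p \<le> q" "q \<le> r" | "p \<le> r" "r \<le> q" | "q \<le> p" "p \<le> r" | "q \<le> r" "r \<le> p"
      | "r \<le> p" "p \<le> q" | "r \<le> q" "q \<le> p"
      by linarith
    then show ?thesis
    proof cases
      case 1 then show ?thesis by (intro exI[of _ P] exI[of _ Q] exI[of _ R]) (simp add: *)
    next
      case 2 then show ?thesis by (intro exI[of _ P] exI[of _ R] exI[of _ Q]) (simp add: sym)
    next
      case 3 then show ?thesis by (intro exI[of _ Q] exI[of _ P] exI[of _ R]) (simp add: sym)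
    next
      case 4 then show ?thesis by (intro exI[of _ Q] exI[of _ R] exI[of _ P]) (simp add: *)
    next
      case 5 then show ?thesis by (intro exI[of _ R] exI[of _ P] exI[of _ Q]) (simp add: *)
    next
      case 6 then show ?thesis by (intro exI[of _ R] exI[of _ Q] exI[of _ P]) (simp add: sym)
    qed
  qed
  then obtain P' Q' R' where eq: "{#P', Q', R'#} = {#P, Q, R#}"
    and le: "angle_at R' P' Q' \<le> angle_at P' Q' R'" "angle_at P' Q' R' \<le> angle_at Q' R' P'"
    by blast
  have "sorted_angles (P, Q, R) = sorted_angles (P', Q', R')"
    using eq by (rule sorted_angles_cong_mset[OF sym])
  also have "\<dots> = [angle_at R' P' Q', angle_at P' Q' R', angle_at Q' R' P']"
    using le by simp
  finally show thesis
    using eq that by blast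
qed

section \<open>From equal apexes to similar triangles\<close>

text \<open>Expresses the apex by the ratio of the two sides meeting at \<open>P\<close> and the
  angle between them, which is the data of the side-angle-side criterion.\<close>

lemma apex_vertices:
  assumes "\<not> collinear {P, Q, R}"
  shows "apex [angle_at R P Q, angle_at P Q R, angle_at Q R P] =
    of_real (norm (R - P) / norm (Q - P)) * cis (angle_at R P Q)"
  using sin_angle_at_ratio[OF assms] by (simp add: apex_def numeral_2_eq_2)

text \<open>Since \<open>u\<close> and \<open>v\<close> form a basis of the plane, a linear map can
  be prescribed on them. It keeps their Gram matrix, hence by bilinearity all inner
  products.\<close>

lemma orthogonal_transformation_of_pair:
  fixes u v u' v' :: "real^2"
  assumes "\<not> collinear {0, u, v}"
    and "u' \<bullet> u' = u \<bullet> u" "v' \<bullet> v' = v \<bullet> v" "u' \<bullet> v' = u \<bullet> v"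
  obtains g where "orthogonal_transformation g" "g u = u'" "g v = v'"
proof -
  have nz: "u \<noteq> 0" and mult: "v \<noteq> c *\<^sub>R u" for c
    using assms(1) by (auto simp: collinear_lemma)
  have "u \<noteq> v"
    using mult[of 1] by simp
  have ind: "independent {u, v}"
    using nz mult by (auto simp: independent_insert span_singleton insert_commute[of u v])
  \<comment> \<open>Two independent vectors span the plane by dimension count.\<close>
  then have span: "span {u, v} = UNIV"
    by (intro dim_eq_full[THEN iffD1]) (simp add: dim_eq_card_independent \<open>u \<noteq> v\<close>)
  obtain g where "linear g" and g: "\<forall>x\<in>{u, v}. g x = (if x = u then u' else v')"
    using linear_independent_extend[OF ind, of "\<lambda>x. if x = u then u' else v'"] by blast
  then have gu: "g u = u'" and gv: "g v = v'"
    using \<open>u \<noteq> v\<close> by auto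
  have "g x \<bullet> g y = x \<bullet> y" for x y
  proof -
    have "\<exists>a b. z = a *\<^sub>R u + b *\<^sub>R v" for z
    proof -
      have "z \<in> span {u, v}"
        using span by simp
      then obtain a where "z - a *\<^sub>R u \<in> span {v}"
        by (auto simp: span_breakdown_eq)
      then obtain b where "z - a *\<^sub>R u = b *\<^sub>R v"
        by (auto simp: span_singleton)
      then show ?thesis
        by (metis add.commute diff_add_cancel)
    qed
    then obtain a b c d where "x = a *\<^sub>R u + b *\<^sub>R v" "y = c *\<^sub>R u + d *\<^sub>R v"
      by metis
    then show ?thesis
      using assms(2-)
      by (simp add: linear_add[OF \<open>linear g\<close>] linear_scale[OF \<open>linear g\<close>] gu gv inner_simps inner_commute)
  qed
  then have "orthogonal_transformation g"
    using \<open>linear g\<close> by (simp add: orthogonal_transformation_def)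
  then show thesis
    using gu gv by (rule that)
qed

text \<open>Side-angle-side criterion: the edge vectors at \<open>P'\<close>, divided by the scale
  factor, have the same Gram matrix as those at \<open>P\<close>, so an orthogonal map links the two
  pairs.\<close>

lemma similarity_map_SAS:
  assumes nc: "\<not> collinear {P, Q, R}" and nc': "\<not> collinear {P', Q', R'}"
    and ratio: "norm (R - P) / norm (Q - P) = norm (R' - P') / norm (Q' - P')"
    and cos: "cos (angle_at R P Q) = cos (angle_at R' P' Q')"
  obtains f where "similarity_map f" "f P = P'" "f Q = Q'" "f R = R'"
proof -
  have ne: "P \<noteq> Q" "P \<noteq> R" "P' \<noteq> Q'" "P' \<noteq> R'"
    using nc nc' by (auto simp: insert_commute)
  \<comment> \<open>The scale factor is read off from one side; \<open>ratio\<close> forces the same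
    factor on the other.\<close>
  define k where "k = norm (Q' - P') / norm (Q - P)"
  have "k > 0"
    using ne by (simp add: k_def)
  have kQ: "norm (Q' - P') = k * norm (Q - P)" and kR: "norm (R' - P') = k * norm (R - P)"
    using ratio ne by (auto simp: k_def field_simps)
  have "(R' - P') \<bullet> (Q' - P') = cos (angle_at R' P' Q') * (norm (R' - P') * norm (Q' - P'))"
    using ne by (simp add: cos_angle_at)
  also have "\<dots> = k\<^sup>2 * (cos (angle_at R P Q) * (norm (R - P) * norm (Q - P)))"
    by (simp add: cos kQ kR power2_eq_square)
  also have "\<dots> = k\<^sup>2 * ((R - P) \<bullet> (Q - P))"
    using ne by (simp add: cos_angle_at)
  finally have kQR: "(Q' - P') \<bullet> (R' - P') = k\<^sup>2 * ((Q - P) \<bullet> (R - P))"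
    by (simp add: inner_commute)
  have "\<not> collinear {0, Q - P, R - P}"
    using nc collinear_3[of Q P R] by (simp add: insert_commute[of Q P])
  then obtain g where g: "orthogonal_transformation g"
    "g (Q - P) = (1 / k) *\<^sub>R (Q' - P')" "g (R - P) = (1 / k) *\<^sub>R (R' - P')"
  proof (rule orthogonal_transformation_of_pair)
    show "((1 / k) *\<^sub>R (Q' - P')) \<bullet> ((1 / k) *\<^sub>R (Q' - P')) = (Q - P) \<bullet> (Q - P)"
      "((1 / k) *\<^sub>R (R' - P')) \<bullet> ((1 / k) *\<^sub>R (R' - P')) = (R - P) \<bullet> (R - P)"
      using \<open>k > 0\<close> by (simp_all add: dot_square_norm kQ kR power2_eq_square)
    show "((1 / k) *\<^sub>R (Q' - P')) \<bullet> ((1 / k) *\<^sub>R (R' - P')) = (Q - P) \<bullet> (R - P)"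
      using \<open>k > 0\<close> kQR by (simp add: power2_eq_square)
  qed
  \<comment> \<open>The translation part is chosen so that \<open>P\<close> goes to
    \<open>P'\<close>.\<close>
  define f where "f x = k *\<^sub>R g x + (P' - k *\<^sub>R g P)" for x
  have "similarity_map f"
    unfolding similarity_map_def using g(1) \<open>k > 0\<close> f_def by blast
  moreover have "f x = k *\<^sub>R g (x - P) + P'" for x
    using g(1) by (simp add: f_def orthogonal_transformation_def linear_diff algebra_simps)
  then have "f P = P'" "f Q = Q'" "f R = R'"
    using g \<open>k > 0\<close> by (auto simp: orthogonal_transformation_def linear_0)
  ultimately show thesis
    by (rule that)
qed

lemma similar_triangles_if_apex_eq:
  assumes "is_triangle A" "is_triangle B"
    and apex: "apex (sorted_angles A) = apex (sorted_angles B)"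
  shows "similar_triangles A B"
proof -
  obtain P0 Q0 R0 P0' Q0' R0' where AB: "A = (P0, Q0, R0)" "B = (P0', Q0', R0')"
    by (metis prod_cases3)
  obtain P Q R where A: "{#P, Q, R#} = {#P0, Q0, R0#}"
    "sorted_angles A = [angle_at R P Q, angle_at P Q R, angle_at Q R P]"
    using sorted_angles_vertices AB by metis
  obtain P' Q' R' where B: "{#P', Q', R'#} = {#P0', Q0', R0'#}"
    "sorted_angles B = [angle_at R' P' Q', angle_at P' Q' R', angle_at Q' R' P']"
    using sorted_angles_vertices AB by metis
  \<comment> \<open>Collinearity depends only on the set of vertices, so it is unaffected by
    relabelling.\<close>
  have nc: "\<not> collinear {P, Q, R}" "\<not> collinear {P', Q', R'}"
    using assms(1,2) AB arg_cong[OF A(1), of set_mset] arg_cong[OF B(1), of set_mset] by auto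
  then have ne: "P \<noteq> Q" "P \<noteq> R" "P' \<noteq> Q'" "P' \<noteq> R'"
    by (auto simp: insert_commute)
  define r r' where "r = norm (R - P) / norm (Q - P)" and "r' = norm (R' - P') / norm (Q' - P')"
  have "r > 0" "r' > 0"
    using ne by (auto simp: r_def r'_def)
  have eq: "of_real r * cis (angle_at R P Q) = of_real r' * cis (angle_at R' P' Q')"
    using apex unfolding A(2) B(2) apex_vertices[OF nc(1)] apex_vertices[OF nc(2)] r_def r'_def .
  \<comment> \<open>Norms give equal moduli because both are positive. Cancelling them in the real
    parts gives equal cosines, which is all that side-angle-side asks for.\<close>
  have "r = r'"
    using arg_cong[OF eq, of norm] \<open>r > 0\<close> \<open>r' > 0\<close> by (simp add: norm_mult)
  moreover have "cos (angle_at R P Q) = cos (angle_at R' P' Q')"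
    using arg_cong[OF eq, of Re] \<open>r = r'\<close> \<open>r > 0\<close> by simp
  ultimately obtain f where f: "similarity_map f" "f P = P'" "f Q = Q'" "f R = R'"
    using similarity_map_SAS nc unfolding r_def r'_def by metis
  have "{#f P0, f Q0, f R0#} = {#f P, f Q, f R#}"
    using arg_cong[OF A(1), of "image_mset f"] by simp
  also have "\<dots> = {#P0', Q0', R0'#}"
    using f B(1) by simp
  finally show ?thesis
    using f(1) AB by auto
qed

theorem lemma10:
  fixes A B C :: triangle
  assumes "is_triangle A" and "is_triangle B" and "is_triangle C"
  shows "triangle_tau A B \<ge> 0 \<and>
    (triangle_tau A B = 0 \<longleftrightarrow> similar_triangles A B) \<and>
    triangle_tau A B = triangle_tau B A \<and>
    triangle_tau A C \<le> triangle_tau A B + triangle_tau B C"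
proof -
  \<comment> \<open>Geometry enters only through the zero-distance claim; the other three claims are
    properties of \<open>dist\<close> on the complex plane.\<close>
  have "apex (sorted_angles A) = apex (sorted_angles B) \<longleftrightarrow> similar_triangles A B"
    using similar_triangles_if_apex_eq[OF assms(1,2)] similar_triangles_sorted_angles by metis
  then show ?thesis
    by (simp add: triangle_tau_def tau_eq_dist_apex dist_commute dist_triangle)
qed

end
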